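(* (1) For all $\varphi\in\mathcal{L}_{Par}$: if $\mathsf{G}\vdash\varphi^{nf}$ then $\mathsf{Par}\vdash\varphi$. (2) For all $\xi\in\mathcal{L}_{NF}$: if $\mathsf{G}\vdash\xi$ then $\mathsf{Par}\vdash\xi^{par}$.
   Context: Fix countable sets $\mathsf{P}_0$ (atomic propositions) and $\mathsf{G}_0$ (atomic games). Parikh's language: formulas $\mathcal{L}_{Par}$ and games $\mathcal{G}_{Par}$ given by $\varphi ::= p \mid \neg\varphi \mid \varphi\lor\varphi \mid \langle\gamma\rangle\varphi$, $\gamma ::= g \mid \gamma;\gamma \mid \gamma\sqcup\gamma \mid \gamma^* \mid \gamma^d \mid \varphi?$ ($\to,\land,\leftrightarrow$ abbreviations). Normal-form language: formulas $\mathcal{L}_{NF}$ and games $\mathcal{G}_{NF}$ given by $\varphi ::= p \mid \neg p \mid \varphi\lor\varphi \mid \varphi\land\varphi \mid \langle\gamma\rangle\varphi$, $\gamma ::= g \mid g^d \mid \gamma;\gamma \mid \gamma\sqcup\gamma \mid \gamma\sqcap\gamma \mid \gamma^* \mid \gamma^\times \mid \varphi? \mid \varphi!$. Translation $(\cdot)^{nf}:\mathcal{L}_{Par}\to\mathcal{L}_{NF}$ (dual and negation normal form), defined recursively: $p^{nf}=p$, $(\neg p)^{nf}=\neg p$, $(\neg\neg\varphi)^{nf}=\varphi^{nf}$, $(\varphi\lor\psi)^{nf}=\varphi^{nf}\lor\psi^{nf}$, $(\neg(\varphi\lor\psi))^{nf}=(\neg\varphi)^{nf}\land(\neg\psi)^{nf}$,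 $(\langle\gamma\rangle\varphi)^{nf}=\langle\gamma^{nf}\rangle\varphi^{nf}$, $(\neg\langle\gamma\rangle\varphi)^{nf}=\langle(\gamma^d)^{nf}\rangle(\neg\varphi)^{nf}$; on games $g^{nf}=g$, $(\gamma;\delta)^{nf}=\gamma^{nf};\delta^{nf}$, $(\gamma\sqcup\delta)^{nf}=\gamma^{nf}\sqcup\delta^{nf}$, $(\gamma^* )^{nf}=(\gamma^{nf})^*$, $(\varphi?)^{nf}=\varphi^{nf}?$, $(g^d)^{nf}=g^d$, $((\gamma^d)^d)^{nf}=\gamma^{nf}$, $((\gamma\sqcup\delta)^d)^{nf}=(\gamma^d)^{nf}\sqcap(\delta^d)^{nf}$, $((\gamma;\delta)^d)^{nf}=(\gamma^d)^{nf};(\delta^d)^{nf}$, $((\gamma^* )^d)^{nf}=((\gamma^d)^{nf})^\times$, $((\varphi?)^d)^{nf}=(\neg\varphi)^{nf}!$. Translation $(\cdot)^{par}:\mathcal{L}_{NF}\to\mathcal{L}_{Par}$: $p^{par}=p$, $(\neg p)^{par}=\neg p$, $(\varphi\lor\psi)^{par}=\varphi^{par}\lor\psi^{par}$, $(\varphi\land\psi)^{par}=\neg(\neg\varphi^{par}\lor\neg\psi^{par})$, $(\langle\gamma\rangle\varphi)^{par}=\langle\gamma^{par}\rangle\varphi^{par}$; $g^{par}=g$, $(g^d)^{par}=g^d$, $(\gamma\sqcup\delta)^{par}=\gamma^{par}\sqcup\delta^{par}$, $(\gamma\sqcap\delta)^{par}=((\gamma^{par})^d\sqcup(\delta^{par})^d)^d$,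 $(\gamma;\delta)^{par}=\gamma^{par};\delta^{par}$, $(\gamma^* )^{par}=(\gamma^{par})^*$, $(\gamma^\times)^{par}=(((\gamma^{par})^d)^* )^d$, $(\varphi?)^{par}=\varphi^{par}?$, $(\varphi!)^{par}=((\neg\varphi^{par})?)^d$. $\mathsf{Par}$ is the Hilbert system over $\mathcal{L}_{Par}$ with axioms: propositional tautologies; $\langle\gamma;\delta\rangle\varphi\leftrightarrow\langle\gamma\rangle\langle\delta\rangle\varphi$; $\langle\gamma\sqcup\delta\rangle\varphi\leftrightarrow\langle\gamma\rangle\varphi\lor\langle\delta\rangle\varphi$; $\langle\gamma^*\rangle\varphi\leftrightarrow\varphi\lor\langle\gamma\rangle\langle\gamma^*\rangle\varphi$; $\langle\psi?\rangle\varphi\leftrightarrow\psi\land\varphi$; $\langle\gamma^d\rangle\varphi\leftrightarrow\neg\langle\gamma\rangle\neg\varphi$; rules modus ponens, monotonicity (from $\varphi\to\psi$ infer $\langle\gamma\rangle\varphi\to\langle\gamma\rangle\psi$), bar induction (from $\langle\gamma\rangle\varphi\to\varphi$ infer $\langle\gamma^*\rangle\varphi\to\varphi$). Complement on $\mathcal{L}_{NF}$: $\overline p=\neg p$, $\overline{\neg p}=p$, $\overline{\varphi\lor\psi}=\overline\varphi\land\overline\psi$, $\overline{\varphi\land\psi}=\overline\varphi\lor\overline\psi$, $\overline{\langle\gamma\rangle\varphi}=\langle\check\gamma\rangle\overline\varphi$, with $\check g=g^d$, $\check{(g^d)}=g$, $\check{(\gamma;\delta)}=\check\gamma;\check\delta$,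 $\check{(\gamma\sqcup\delta)}=\check\gamma\sqcap\check\delta$, $\check{(\gamma\sqcap\delta)}=\check\gamma\sqcup\check\delta$, $\check{(\gamma^* )}=(\check\gamma)^\times$, $\check{(\gamma^\times)}=(\check\gamma)^*$, $\check{(\varphi?)}=\overline\varphi!$, $\check{(\varphi!)}=\overline\varphi?$; for finite $\Phi=\{\varphi_1,\dots,\varphi_n\}$, $\overline\Phi:=\overline{\varphi_1}\land\dots\land\overline{\varphi_n}$. $\mathsf{G}$ is the sequent calculus on finite sets of $\mathcal{L}_{NF}$-formulas with rules: axiom $\Phi,\overline\Phi$; weakening $\Phi/\Phi,\varphi$; $\varphi,\psi/\langle g\rangle\varphi,\langle g^d\rangle\psi$; $\Phi,\varphi,\psi/\Phi,\varphi\lor\psi$; $\Phi,\varphi$ and $\Phi,\psi/\Phi,\varphi\land\psi$; $\Phi,\varphi\lor\langle\gamma\rangle\langle\gamma^*\rangle\varphi/\Phi,\langle\gamma^*\rangle\varphi$; $\Phi,\varphi\land\langle\gamma\rangle\langle\gamma^\times\rangle\varphi/\Phi,\langle\gamma^\times\rangle\varphi$; $\Phi,\langle\gamma\rangle\varphi\lor\langle\delta\rangle\varphi/\Phi,\langle\gamma\sqcup\delta\rangle\varphi$; $\Phi,\langle\gamma\rangle\varphi\land\langle\delta\rangle\varphi/\Phi,\langle\gamma\sqcap\delta\rangle\varphi$; $\Phi,\psi\land\varphi/\Phi,\langle\psi?\rangle\varphi$; $\Phi,\psi\lor\varphi/\Phi,\langle\psi!\rangle\varphi$; deep rules (for $\psi(\cdot)$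 a formula with a unique placeholder occurrence of formula or game sort): $\Phi,\psi(\gamma)/\Phi,\psi(\chi!;\gamma)$, $\Phi,\psi(\varphi)/\Phi,\psi(\langle\chi!\rangle\varphi)$, $\Phi,\psi(\langle\gamma\rangle\langle\delta\rangle\varphi)/\Phi,\psi(\langle\gamma;\delta\rangle\varphi)$; and $\Phi,\varphi\land\langle\gamma\rangle\langle(\overline\Phi!;\gamma)^\times\rangle\langle\overline\Phi!\rangle\varphi/\Phi,\langle\gamma^\times\rangle\varphi$. $\mathsf{G}\vdash\xi$: there is a finite derivation of $\{\xi\}$ with all leaves axioms. *)

theory Defs
  imports Main "HOL-Library.Countable" "HOL-Library.FSet"
begin

section \<open>Parikh's language and Hilbert system\<close>

datatype ('p, 'g) pform =
    Atom 'p
  | Neg "('p, 'g) pform"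
  | Or "('p, 'g) pform" "('p, 'g) pform"
  | Dia "('p, 'g) pgame" "('p, 'g) pform"
and ('p, 'g) pgame =
    Game 'g
  | Seq "('p, 'g) pgame" "('p, 'g) pgame"
  | Choice "('p, 'g) pgame" "('p, 'g) pgame"
  | Star "('p, 'g) pgame"
  | Dual "('p, 'g) pgame"
  | Test "('p, 'g) pform"

abbreviation And :: "('p, 'g) pform \<Rightarrow> ('p, 'g) pform \<Rightarrow> ('p, 'g) pform" where
  "And \<phi> \<psi> \<equiv> Neg (Or (Neg \<phi>) (Neg \<psi>))"

abbreviation Imp :: "('p, 'g) pform \<Rightarrow> ('p, 'g) pform \<Rightarrow> ('p, 'g) pform" where
  "Imp \<phi> \<psi> \<equiv> Or (Neg \<phi>) \<psi>"

abbreviation Iff :: "('p, 'g) pform \<Rightarrow> ('p, 'g) pform \<Rightarrow> ('p, 'g) pform" where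
  "Iff \<phi> \<psi> \<equiv> And (Imp \<phi> \<psi>) (Imp \<psi> \<phi>)"

text \<open>Propositional evaluation treats atoms and modal formulas \<open>Dia \<gamma> \<phi>\<close> alike as
  propositional letters, so \<open>tautology\<close> covers all substitution instances of classical
  tautologies.\<close>

fun prop_eval :: "(('p, 'g) pform \<Rightarrow> bool) \<Rightarrow> ('p, 'g) pform \<Rightarrow> bool" where
  "prop_eval v (Neg \<phi>) = (\<not> prop_eval v \<phi>)"
| "prop_eval v (Or \<phi> \<psi>) = (prop_eval v \<phi> \<or> prop_eval v \<psi>)"
| "prop_eval v (Atom p) = v (Atom p)"
| "prop_eval v (Dia \<gamma> \<phi>) = v (Dia \<gamma> \<phi>)"

definition tautology :: "('p, 'g) pform \<Rightarrow> bool" where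
  "tautology \<phi> \<longleftrightarrow> (\<forall>v. prop_eval v \<phi>)"

inductive Par :: "('p, 'g) pform \<Rightarrow> bool" where
  taut: "tautology \<phi> \<Longrightarrow> Par \<phi>"
| seq: "Par (Iff (Dia (Seq \<gamma> \<delta>) \<phi>) (Dia \<gamma> (Dia \<delta> \<phi>)))"
| choice: "Par (Iff (Dia (Choice \<gamma> \<delta>) \<phi>) (Or (Dia \<gamma> \<phi>) (Dia \<delta> \<phi>)))"
| star: "Par (Iff (Dia (Star \<gamma>) \<phi>) (Or \<phi> (Dia \<gamma> (Dia (Star \<gamma>) \<phi>))))"
| test: "Par (Iff (Dia (Test \<psi>) \<phi>) (And \<psi> \<phi>))"
| dual: "Par (Iff (Dia (Dual \<gamma>) \<phi>) (Neg (Dia \<gamma> (Neg \<phi>))))"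
| mp: "Par (Imp \<phi> \<psi>) \<Longrightarrow> Par \<phi> \<Longrightarrow> Par \<psi>"
| mon: "Par (Imp \<phi> \<psi>) \<Longrightarrow> Par (Imp (Dia \<gamma> \<phi>) (Dia \<gamma> \<psi>))"
| bar_ind: "Par (Imp (Dia \<gamma> \<phi>) \<phi>) \<Longrightarrow> Par (Imp (Dia (Star \<gamma>) \<phi>) \<phi>)"

section \<open>The normal-form language\<close>

text \<open>\<open>NChoice\<close>/\<open>NDChoice\<close> are angelic/demonic choice (square cup and cap), \<open>NStar\<close>/\<open>NCross\<close>
  angelic/demonic iteration, and \<open>NTest\<close>/\<open>NDTest\<close> angelic/demonic test (\<open>?\<close> and \<open>!\<close>).\<close>

datatype ('p, 'g) nform =
    NAtom 'p
  | NNegAtom 'p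
  | NOr "('p, 'g) nform" "('p, 'g) nform"
  | NAnd "('p, 'g) nform" "('p, 'g) nform"
  | NDia "('p, 'g) ngame" "('p, 'g) nform"
and ('p, 'g) ngame =
    NGame 'g
  | NDualGame 'g
  | NSeq "('p, 'g) ngame" "('p, 'g) ngame"
  | NChoice "('p, 'g) ngame" "('p, 'g) ngame"
  | NDChoice "('p, 'g) ngame" "('p, 'g) ngame"
  | NStar "('p, 'g) ngame"
  | NCross "('p, 'g) ngame"
  | NTest "('p, 'g) nform"
  | NDTest "('p, 'g) nform"

fun nf :: "('p, 'g) pform \<Rightarrow> ('p, 'g) nform"
and nf_game :: "('p, 'g) pgame \<Rightarrow> ('p, 'g) ngame" where
  "nf (Atom p) = NAtom p"
| "nf (Neg (Atom p)) = NNegAtom p"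
| "nf (Neg (Neg \<phi>)) = nf \<phi>"
| "nf (Or \<phi> \<psi>) = NOr (nf \<phi>) (nf \<psi>)"
| "nf (Neg (Or \<phi> \<psi>)) = NAnd (nf (Neg \<phi>)) (nf (Neg \<psi>))"
| "nf (Dia \<gamma> \<phi>) = NDia (nf_game \<gamma>) (nf \<phi>)"
| "nf (Neg (Dia \<gamma> \<phi>)) = NDia (nf_game (Dual \<gamma>)) (nf (Neg \<phi>))"
| "nf_game (Game g) = NGame g"
| "nf_game (Seq \<gamma> \<delta>) = NSeq (nf_game \<gamma>) (nf_game \<delta>)"
| "nf_game (Choice \<gamma> \<delta>) = NChoice (nf_game \<gamma>) (nf_game \<delta>)"
| "nf_game (Star \<gamma>) = NStar (nf_game \<gamma>)"
| "nf_game (Test \<phi>) = NTest (nf \<phi>)"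
| "nf_game (Dual (Game g)) = NDualGame g"
| "nf_game (Dual (Dual \<gamma>)) = nf_game \<gamma>"
| "nf_game (Dual (Choice \<gamma> \<delta>)) = NDChoice (nf_game (Dual \<gamma>)) (nf_game (Dual \<delta>))"
| "nf_game (Dual (Seq \<gamma> \<delta>)) = NSeq (nf_game (Dual \<gamma>)) (nf_game (Dual \<delta>))"
| "nf_game (Dual (Star \<gamma>)) = NCross (nf_game (Dual \<gamma>))"
| "nf_game (Dual (Test \<phi>)) = NDTest (nf (Neg \<phi>))"

primrec par :: "('p, 'g) nform \<Rightarrow> ('p, 'g) pform"
and par_game :: "('p, 'g) ngame \<Rightarrow> ('p, 'g) pgame" where
  "par (NAtom p) = Atom p"
| "par (NNegAtom p) = Neg (Atom p)"
| "par (NOr \<phi> \<psi>) = Or (par \<phi>) (par \<psi>)"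
| "par (NAnd \<phi> \<psi>) = Neg (Or (Neg (par \<phi>)) (Neg (par \<psi>)))"
| "par (NDia \<gamma> \<phi>) = Dia (par_game \<gamma>) (par \<phi>)"
| "par_game (NGame g) = Game g"
| "par_game (NDualGame g) = Dual (Game g)"
| "par_game (NSeq \<gamma> \<delta>) = Seq (par_game \<gamma>) (par_game \<delta>)"
| "par_game (NChoice \<gamma> \<delta>) = Choice (par_game \<gamma>) (par_game \<delta>)"
| "par_game (NDChoice \<gamma> \<delta>) = Dual (Choice (Dual (par_game \<gamma>)) (Dual (par_game \<delta>)))"
| "par_game (NStar \<gamma>) = Star (par_game \<gamma>)"
| "par_game (NCross \<gamma>) = Dual (Star (Dual (par_game \<gamma>)))"
| "par_game (NTest \<phi>) = Test (par \<phi>)"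
| "par_game (NDTest \<phi>) = Dual (Test (Neg (par \<phi>)))"

primrec compl :: "('p, 'g) nform \<Rightarrow> ('p, 'g) nform"
and compl_game :: "('p, 'g) ngame \<Rightarrow> ('p, 'g) ngame" where
  "compl (NAtom p) = NNegAtom p"
| "compl (NNegAtom p) = NAtom p"
| "compl (NOr \<phi> \<psi>) = NAnd (compl \<phi>) (compl \<psi>)"
| "compl (NAnd \<phi> \<psi>) = NOr (compl \<phi>) (compl \<psi>)"
| "compl (NDia \<gamma> \<phi>) = NDia (compl_game \<gamma>) (compl \<phi>)"
| "compl_game (NGame g) = NDualGame g"
| "compl_game (NDualGame g) = NGame g"
| "compl_game (NSeq \<gamma> \<delta>) = NSeq (compl_game \<gamma>) (compl_game \<delta>)"
| "compl_game (NChoice \<gamma> \<delta>) = NDChoice (compl_game \<gamma>) (compl_game \<delta>)"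
| "compl_game (NDChoice \<gamma> \<delta>) = NChoice (compl_game \<gamma>) (compl_game \<delta>)"
| "compl_game (NStar \<gamma>) = NCross (compl_game \<gamma>)"
| "compl_game (NCross \<gamma>) = NStar (compl_game \<gamma>)"
| "compl_game (NTest \<phi>) = NDTest (compl \<phi>)"
| "compl_game (NDTest \<phi>) = NTest (compl \<phi>)"

text \<open>\<open>compl_conj \<Phi> \<chi>\<close>: \<open>\<chi>\<close> is a conjunction of the complements of the elements of \<open>\<Phi>\<close>, each
  taken once. A finite set determines neither an order nor a bracketing of this conjunction, so
  every order and every bracketing is admitted. The empty conjunction is truth; as the
  language has no constant for it, any \<open>p \<or> \<not>p\<close> is admitted.\<close>

inductive compl_conj :: "('p, 'g) nform fset \<Rightarrow> ('p, 'g) nform \<Rightarrow> bool" where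
  empty: "compl_conj {||} (NOr (NAtom p) (NNegAtom p))"
| single: "compl_conj {|\<phi>|} (compl \<phi>)"
| union: "compl_conj \<Phi> \<alpha> \<Longrightarrow> compl_conj \<Psi> \<beta> \<Longrightarrow> \<Phi> \<noteq> {||} \<Longrightarrow> \<Psi> \<noteq> {||} \<Longrightarrow> \<Phi> |\<inter>| \<Psi> = {||} \<Longrightarrow>
    compl_conj (\<Phi> |\<union>| \<Psi>) (NAnd \<alpha> \<beta>)"

lemma compl_conj_exists: "\<exists>\<chi>. compl_conj \<Phi> \<chi>"
proof (induction \<Phi>)
  case empty
  show ?case by (blast intro: compl_conj.empty)
next
  case (insert \<phi> \<Phi>)
  then obtain \<alpha> where "compl_conj \<Phi> \<alpha>" by blast
  show ?case
  proof (cases "\<Phi> = {||}")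
    case True
    then show ?thesis by (blast intro: compl_conj.single)
  next
    case False
    have "compl_conj ({|\<phi>|} |\<union>| \<Phi>) (NAnd (compl \<phi>) \<alpha>)"
      by (rule compl_conj.union) (use insert False \<open>compl_conj \<Phi> \<alpha>\<close> compl_conj.single in auto)
    then show ?thesis by auto
  qed
qed

section \<open>One-hole contexts\<close>

text \<open>Formulas and games with exactly one placeholder, which is of formula sort in \<open>fctx\<close>,
  \<open>fgctx\<close> and of game sort in \<open>gctx\<close>, \<open>ggctx\<close>. Negation and dual only occur in the indivisible
  literals \<open>NNegAtom p\<close> and \<open>NDualGame g\<close>, so no context descends through them.\<close>

datatype ('p, 'g) fctx =
    FHole
  | FOrL "('p, 'g) fctx" "('p, 'g) nform"
  | FOrR "('p, 'g) nform" "('p, 'g) fctx"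
  | FAndL "('p, 'g) fctx" "('p, 'g) nform"
  | FAndR "('p, 'g) nform" "('p, 'g) fctx"
  | FDiaL "('p, 'g) fgctx" "('p, 'g) nform"
  | FDiaR "('p, 'g) ngame" "('p, 'g) fctx"
and ('p, 'g) fgctx =
    FSeqL "('p, 'g) fgctx" "('p, 'g) ngame"
  | FSeqR "('p, 'g) ngame" "('p, 'g) fgctx"
  | FChoiceL "('p, 'g) fgctx" "('p, 'g) ngame"
  | FChoiceR "('p, 'g) ngame" "('p, 'g) fgctx"
  | FDChoiceL "('p, 'g) fgctx" "('p, 'g) ngame"
  | FDChoiceR "('p, 'g) ngame" "('p, 'g) fgctx"
  | FStar "('p, 'g) fgctx"
  | FCross "('p, 'g) fgctx"
  | FTest "('p, 'g) fctx"
  | FDTest "('p, 'g) fctx"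

primrec ffill :: "('p, 'g) fctx \<Rightarrow> ('p, 'g) nform \<Rightarrow> ('p, 'g) nform"
and fgfill :: "('p, 'g) fgctx \<Rightarrow> ('p, 'g) nform \<Rightarrow> ('p, 'g) ngame" where
  "ffill FHole \<xi> = \<xi>"
| "ffill (FOrL C \<phi>) \<xi> = NOr (ffill C \<xi>) \<phi>"
| "ffill (FOrR \<phi> C) \<xi> = NOr \<phi> (ffill C \<xi>)"
| "ffill (FAndL C \<phi>) \<xi> = NAnd (ffill C \<xi>) \<phi>"
| "ffill (FAndR \<phi> C) \<xi> = NAnd \<phi> (ffill C \<xi>)"
| "ffill (FDiaL D \<phi>) \<xi> = NDia (fgfill D \<xi>) \<phi>"
| "ffill (FDiaR \<gamma> C) \<xi> = NDia \<gamma> (ffill C \<xi>)"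
| "fgfill (FSeqL D \<gamma>) \<xi> = NSeq (fgfill D \<xi>) \<gamma>"
| "fgfill (FSeqR \<gamma> D) \<xi> = NSeq \<gamma> (fgfill D \<xi>)"
| "fgfill (FChoiceL D \<gamma>) \<xi> = NChoice (fgfill D \<xi>) \<gamma>"
| "fgfill (FChoiceR \<gamma> D) \<xi> = NChoice \<gamma> (fgfill D \<xi>)"
| "fgfill (FDChoiceL D \<gamma>) \<xi> = NDChoice (fgfill D \<xi>) \<gamma>"
| "fgfill (FDChoiceR \<gamma> D) \<xi> = NDChoice \<gamma> (fgfill D \<xi>)"
| "fgfill (FStar D) \<xi> = NStar (fgfill D \<xi>)"
| "fgfill (FCross D) \<xi> = NCross (fgfill D \<xi>)"
| "fgfill (FTest C) \<xi> = NTest (ffill C \<xi>)"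
| "fgfill (FDTest C) \<xi> = NDTest (ffill C \<xi>)"

datatype ('p, 'g) gctx =
    GOrL "('p, 'g) gctx" "('p, 'g) nform"
  | GOrR "('p, 'g) nform" "('p, 'g) gctx"
  | GAndL "('p, 'g) gctx" "('p, 'g) nform"
  | GAndR "('p, 'g) nform" "('p, 'g) gctx"
  | GDiaL "('p, 'g) ggctx" "('p, 'g) nform"
  | GDiaR "('p, 'g) ngame" "('p, 'g) gctx"
and ('p, 'g) ggctx =
    GHole
  | GSeqL "('p, 'g) ggctx" "('p, 'g) ngame"
  | GSeqR "('p, 'g) ngame" "('p, 'g) ggctx"
  | GChoiceL "('p, 'g) ggctx" "('p, 'g) ngame"
  | GChoiceR "('p, 'g) ngame" "('p, 'g) ggctx"
  | GDChoiceL "('p, 'g) ggctx" "('p, 'g) ngame"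
  | GDChoiceR "('p, 'g) ngame" "('p, 'g) ggctx"
  | GStar "('p, 'g) ggctx"
  | GCross "('p, 'g) ggctx"
  | GTest "('p, 'g) gctx"
  | GDTest "('p, 'g) gctx"

primrec gfill :: "('p, 'g) gctx \<Rightarrow> ('p, 'g) ngame \<Rightarrow> ('p, 'g) nform"
and ggfill :: "('p, 'g) ggctx \<Rightarrow> ('p, 'g) ngame \<Rightarrow> ('p, 'g) ngame" where
  "gfill (GOrL C \<phi>) \<eta> = NOr (gfill C \<eta>) \<phi>"
| "gfill (GOrR \<phi> C) \<eta> = NOr \<phi> (gfill C \<eta>)"
| "gfill (GAndL C \<phi>) \<eta> = NAnd (gfill C \<eta>) \<phi>"
| "gfill (GAndR \<phi> C) \<eta> = NAnd \<phi> (gfill C \<eta>)"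
| "gfill (GDiaL D \<phi>) \<eta> = NDia (ggfill D \<eta>) \<phi>"
| "gfill (GDiaR \<gamma> C) \<eta> = NDia \<gamma> (gfill C \<eta>)"
| "ggfill GHole \<eta> = \<eta>"
| "ggfill (GSeqL D \<gamma>) \<eta> = NSeq (ggfill D \<eta>) \<gamma>"
| "ggfill (GSeqR \<gamma> D) \<eta> = NSeq \<gamma> (ggfill D \<eta>)"
| "ggfill (GChoiceL D \<gamma>) \<eta> = NChoice (ggfill D \<eta>) \<gamma>"
| "ggfill (GChoiceR \<gamma> D) \<eta> = NChoice \<gamma> (ggfill D \<eta>)"
| "ggfill (GDChoiceL D \<gamma>) \<eta> = NDChoice (ggfill D \<eta>) \<gamma>"
| "ggfill (GDChoiceR \<gamma> D) \<eta> = NDChoice \<gamma> (ggfill D \<eta>)"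
| "ggfill (GStar D) \<eta> = NStar (ggfill D \<eta>)"
| "ggfill (GCross D) \<eta> = NCross (ggfill D \<eta>)"
| "ggfill (GTest C) \<eta> = NTest (gfill C \<eta>)"
| "ggfill (GDTest C) \<eta> = NDTest (gfill C \<eta>)"

section \<open>The sequent calculus\<close>

text \<open>A sequent \<open>\<Phi>, \<phi>\<close> is \<open>finsert \<phi> \<Phi>\<close>; here \<open>\<phi>\<close> may already be an element of \<open>\<Phi>\<close>.\<close>

inductive G_seq :: "('p, 'g) nform fset \<Rightarrow> bool" where
  ax: "compl_conj \<Phi> \<chi> \<Longrightarrow> G_seq (finsert \<chi> \<Phi>)"
| weak: "G_seq \<Phi> \<Longrightarrow> G_seq (finsert \<phi> \<Phi>)"
| modal: "G_seq {|\<phi>, \<psi>|} \<Longrightarrow> G_seq {|NDia (NGame g) \<phi>, NDia (NDualGame g) \<psi>|}"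
| disj: "G_seq (finsert \<phi> (finsert \<psi> \<Phi>)) \<Longrightarrow> G_seq (finsert (NOr \<phi> \<psi>) \<Phi>)"
| conj: "G_seq (finsert \<phi> \<Phi>) \<Longrightarrow> G_seq (finsert \<psi> \<Phi>) \<Longrightarrow> G_seq (finsert (NAnd \<phi> \<psi>) \<Phi>)"
| star: "G_seq (finsert (NOr \<phi> (NDia \<gamma> (NDia (NStar \<gamma>) \<phi>))) \<Phi>) \<Longrightarrow>
    G_seq (finsert (NDia (NStar \<gamma>) \<phi>) \<Phi>)"
| cross: "G_seq (finsert (NAnd \<phi> (NDia \<gamma> (NDia (NCross \<gamma>) \<phi>))) \<Phi>) \<Longrightarrow>
    G_seq (finsert (NDia (NCross \<gamma>) \<phi>) \<Phi>)"
| choice: "G_seq (finsert (NOr (NDia \<gamma> \<phi>) (NDia \<delta> \<phi>)) \<Phi>) \<Longrightarrow>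
    G_seq (finsert (NDia (NChoice \<gamma> \<delta>) \<phi>) \<Phi>)"
| dchoice: "G_seq (finsert (NAnd (NDia \<gamma> \<phi>) (NDia \<delta> \<phi>)) \<Phi>) \<Longrightarrow>
    G_seq (finsert (NDia (NDChoice \<gamma> \<delta>) \<phi>) \<Phi>)"
| test: "G_seq (finsert (NAnd \<psi> \<phi>) \<Phi>) \<Longrightarrow> G_seq (finsert (NDia (NTest \<psi>) \<phi>) \<Phi>)"
| dtest: "G_seq (finsert (NOr \<psi> \<phi>) \<Phi>) \<Longrightarrow> G_seq (finsert (NDia (NDTest \<psi>) \<phi>) \<Phi>)"
| deep_dtest_game: "G_seq (finsert (gfill C \<gamma>) \<Phi>) \<Longrightarrow>
    G_seq (finsert (gfill C (NSeq (NDTest \<chi>) \<gamma>)) \<Phi>)"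
| deep_dtest_form: "G_seq (finsert (ffill D \<phi>) \<Phi>) \<Longrightarrow>
    G_seq (finsert (ffill D (NDia (NDTest \<chi>) \<phi>)) \<Phi>)"
| deep_seq: "G_seq (finsert (ffill D (NDia \<gamma> (NDia \<delta> \<phi>))) \<Phi>) \<Longrightarrow>
    G_seq (finsert (ffill D (NDia (NSeq \<gamma> \<delta>) \<phi>)) \<Phi>)"
| cross_strong: "compl_conj \<Phi> \<chi> \<Longrightarrow>
    G_seq (finsert (NAnd \<phi>
      (NDia \<gamma> (NDia (NCross (NSeq (NDTest \<chi>) \<gamma>)) (NDia (NDTest \<chi>) \<phi>)))) \<Phi>) \<Longrightarrow>
    G_seq (finsert (NDia (NCross \<gamma>) \<phi>) \<Phi>)"

definition G :: "('p, 'g) nform \<Rightarrow> bool" where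
  "G \<xi> \<longleftrightarrow> G_seq {|\<xi>|}"

end

theory Submission
  imports Defs
begin

text \<open>A sequent is read as the disjunction of the translations of its members, and every rule of
  the sequent calculus preserves provability of this disjunction. Propositional reasoning is
  delegated to valuations that satisfy all theorems of the Hilbert system: they
  characterise provability (\<open>Par_iff\<close>), and in them the reduction axioms become equations.

  The only rule that needs an invariant is strengthened demonic iteration. Let \<open>\<chi>\<close> be the negation of
  the side formulas and \<open>J = \<langle>(\<chi>!;\<gamma>)\<^sup>\<times>\<rangle>\<langle>\<chi>!\<rangle>\<phi>\<close>. Unfolding once, \<open>J\<close> entails
  \<open>\<chi> \<or> (\<phi> \<and> \<langle>\<gamma>\<rangle>J)\<close>, while the premise says that \<open>\<chi>\<close> entails \<open>\<phi> \<and> \<langle>\<gamma>\<rangle>J\<close>. So \<open>J\<close> is an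
  invariant contained in \<open>\<phi>\<close>, hence \<open>J\<close> entails \<open>\<langle>\<gamma>\<^sup>\<times>\<rangle>\<phi>\<close>, and then \<open>\<chi>\<close> does as well.

  For the first part, \<open>par (nf \<phi>)\<close> and \<open>\<phi>\<close> are provably equivalent.\<close>

section \<open>Valuations satisfying all theorems\<close>

text \<open>Evaluation stays folded at letters, so that equations about
  \<open>prop_eval v (Dia \<gamma> \<phi>)\<close> can act as rewrite rules.\<close>

declare prop_eval.simps(3,4) [simp del]

section \<open>Maximal theories and separation of unprovable formulas\<close>

definition point :: "(('p, 'g) pform \<Rightarrow> bool) \<Rightarrow> bool" where
  "point v \<longleftrightarrow> (\<forall>\<chi>. Par \<chi> \<longrightarrow> prop_eval v \<chi>)"

text \<open>Assumptions in \<open>T\<close> enter only by propositional reasoning, while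
  monotonicity and bar induction act on theorems alone; this gives the deduction theorem. One
  theorem \<open>\<chi>\<close> suffices because theorems are closed under conjunction, and
  finiteness of \<open>F\<close> is the compactness behind the chain argument.\<close>

definition derives :: "('p, 'g) pform set \<Rightarrow> ('p, 'g) pform \<Rightarrow> bool" where
  "derives T \<phi> \<longleftrightarrow> (\<exists>\<chi> F. Par \<chi> \<and> finite F \<and> F \<subseteq> T \<and>
     (\<forall>v. prop_eval v \<chi> \<longrightarrow> (\<forall>a\<in>F. prop_eval v a) \<longrightarrow> prop_eval v \<phi>))"

lemma derivesI:
  assumes "Par \<chi>" "finite F" "F \<subseteq> T"
    and "\<And>v. prop_eval v \<chi> \<Longrightarrow> \<forall>a\<in>F. prop_eval v a \<Longrightarrow> prop_eval v \<phi>"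
  shows "derives T \<phi>"
  unfolding derives_def using assms by (intro exI[of _ \<chi>] exI[of _ F]) simp

lemma Par_consequence:
  assumes "Par a" and "\<And>v. prop_eval v a \<Longrightarrow> prop_eval v b"
  shows "Par b"
proof -
  have "Par (Imp a b)" using assms(2) by (auto intro!: Par.taut simp: tautology_def)
  then show ?thesis using assms(1) by (rule Par.mp)
qed

lemma Par_And:
  assumes "Par a" "Par b"
  shows "Par (And a b)"
proof -
  have "Par (Imp a (Imp b (And a b)))" by (auto intro!: Par.taut simp: tautology_def)
  then show ?thesis using assms by (blast intro: Par.mp)
qed

lemma derives_finite:
  assumes "finite F" "F \<subseteq> T" "\<And>v. \<forall>a\<in>F. prop_eval v a \<Longrightarrow> prop_eval v \<phi>"
  shows "derives T \<phi>"
proof -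
  have "Par (Imp \<phi> \<phi>)" by (auto intro!: Par.taut simp: tautology_def)
  then show ?thesis using assms by (rule derivesI)
qed

lemma derives_trans:
  assumes "derives T a" "derives (insert a T) b"
  shows "derives T b"
proof -
  obtain \<chi> F where 1: "Par \<chi>" "finite F" "F \<subseteq> T"
    "\<And>v. prop_eval v \<chi> \<Longrightarrow> \<forall>x\<in>F. prop_eval v x \<Longrightarrow> prop_eval v a"
    using assms(1) unfolding derives_def by blast
  obtain \<chi>' F' where 2: "Par \<chi>'" "finite F'" "F' \<subseteq> insert a T"
    "\<And>v. prop_eval v \<chi>' \<Longrightarrow> \<forall>x\<in>F'. prop_eval v x \<Longrightarrow> prop_eval v b"
    using assms(2) unfolding derives_def by blast
  show ?thesis
  proof (rule derivesI[OF Par_And[OF 1(1) 2(1)]])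
    show "finite (F \<union> (F' - {a}))" "F \<union> (F' - {a}) \<subseteq> T" using 1 2 by auto
  next
    fix v assume v: "prop_eval v (And \<chi> \<chi>')" "\<forall>x\<in>F \<union> (F' - {a}). prop_eval v x"
    have "prop_eval v a" using v by (auto intro: 1(4))
    then show "prop_eval v b" using v by (auto intro!: 2(4))
  qed
qed

lemma derives_cases:
  assumes "derives (insert a T) b" "derives (insert (Neg a) T) b"
  shows "derives T b"
proof -
  have "derives T (Imp a b)"
  proof -
    obtain \<chi> F where 1: "Par \<chi>" "finite F" "F \<subseteq> insert a T"
      "\<And>v. prop_eval v \<chi> \<Longrightarrow> \<forall>x\<in>F. prop_eval v x \<Longrightarrow> prop_eval v b"
      using assms(1) unfolding derives_def by blast
    show ?thesis
    proof (rule derivesI[OF 1(1)])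
      show "finite (F - {a})" "F - {a} \<subseteq> T" using 1 by auto
      show "prop_eval v (Imp a b)" if "prop_eval v \<chi>" "\<forall>x\<in>F - {a}. prop_eval v x" for v
        using that 1(4)[of v] by auto
    qed
  qed
  moreover have "derives (insert (Imp a b) T) b"
  proof -
    obtain \<chi> F where 1: "Par \<chi>" "finite F" "F \<subseteq> insert (Neg a) T"
      "\<And>v. prop_eval v \<chi> \<Longrightarrow> \<forall>x\<in>F. prop_eval v x \<Longrightarrow> prop_eval v b"
      using assms(2) unfolding derives_def by blast
    show ?thesis
    proof (rule derivesI[OF 1(1)])
      show "finite (insert (Imp a b) (F - {Neg a}))"
        "insert (Imp a b) (F - {Neg a}) \<subseteq> insert (Imp a b) T" using 1 by auto
    next
      fix v assume v: "prop_eval v \<chi>" "\<forall>x\<in>insert (Imp a b) (F - {Neg a}). prop_eval v x"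
      \<comment> \<open>Where \<open>a\<close> holds, \<open>Imp a b\<close> yields
        \<open>b\<close>; elsewhere \<open>Neg a\<close> is true, so all of \<open>F\<close> is
        available.\<close>
      have "prop_eval v x" if "\<not> prop_eval v a" "x \<in> F" for x
        using that v(2) by (cases "x = Neg a") auto
      then show "prop_eval v b" using v 1(4)[of v] by auto
    qed
  qed
  ultimately show ?thesis by (rule derives_trans)
qed

text \<open>Lindenbaum's lemma by Zorn: a derivation from the union of a chain uses finitely many
  assumptions, hence already works in one member of the chain.\<close>

lemma maximal_underivable:
  assumes "\<not> Par \<phi>"
  shows "\<exists>T. \<not> derives T \<phi> \<and> (\<forall>a. a \<notin> T \<longrightarrow> derives (insert a T) \<phi>)"
proof -
  let ?A = "{T. \<not> derives T \<phi>}"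
  have "{} \<in> ?A"
    using assms by (auto simp: derives_def intro: Par_consequence)
  then have ne: "?A \<noteq> {}" by blast
  have "\<Union>\<C> \<in> ?A" if \<C>: "\<C> \<noteq> {}" "subset.chain ?A \<C>" for \<C>
  proof -
    have "\<not> derives (\<Union>\<C>) \<phi>"
    proof
      assume "derives (\<Union>\<C>) \<phi>"
      then obtain \<chi> F where F: "Par \<chi>" "finite F" "F \<subseteq> \<Union>\<C>"
        "\<And>v. prop_eval v \<chi> \<Longrightarrow> \<forall>a\<in>F. prop_eval v a \<Longrightarrow> prop_eval v \<phi>"
        unfolding derives_def by blast
      obtain T where T: "T \<in> \<C>" "F \<subseteq> T"
        using finite_subset_Union_chain[OF F(2,3) \<C>] by blast
      have "derives T \<phi>" using F(1,2) T(2) F(4) by (rule derivesI)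
      moreover have "\<not> derives T \<phi>" using T(1) \<C>(2) by (auto simp: subset_chain_def)
      ultimately show False by contradiction
    qed
    then show ?thesis by simp
  qed
  then obtain T where T: "T \<in> ?A" "\<And>X. X \<in> ?A \<Longrightarrow> T \<subseteq> X \<Longrightarrow> X = T"
    using subset_Zorn_nonempty[OF ne] by blast
  have "derives (insert a T) \<phi>" if "a \<notin> T" for a
    using T(2)[of "insert a T"] that by blast
  then show ?thesis using T(1) by blast
qed

text \<open>A maximal \<open>T\<close> is closed under derivation, contains exactly one of each
  formula and its negation, and is prime. Membership in \<open>T\<close> is therefore itself a
  valuation; modal formulas count as letters, so no game semantics has to be built.\<close>

lemma separating_point:
  assumes "\<not> Par \<phi>"
  shows "\<exists>v. point v \<and> \<not> prop_eval v \<phi>"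
proof -
  obtain T where T: "\<not> derives T \<phi>" and "\<forall>a. a \<notin> T \<longrightarrow> derives (insert a T) \<phi>"
    using maximal_underivable[OF assms] by blast
  then have max: "derives (insert a T) \<phi>" if "a \<notin> T" for a using that by blast
  have closed: "a \<in> T" if "derives T a" for a
    using derives_trans[OF that max] T by blast
  have fin: "a \<in> T" if "finite F" "F \<subseteq> T" "\<And>v. \<forall>x\<in>F. prop_eval v x \<Longrightarrow> prop_eval v a" for a F
    using derives_finite[OF that] by (rule closed)
  have neg: "Neg a \<in> T \<longleftrightarrow> a \<notin> T" for a
  proof
    show "a \<notin> T" if "Neg a \<in> T"
    proof
      assume "a \<in> T"
      then have "derives T \<phi>" using that by (intro derives_finite[of "{a, Neg a}"]) auto
      then show False using T by contradiction
    qed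
    show "Neg a \<in> T" if "a \<notin> T"
    proof (rule ccontr)
      assume "Neg a \<notin> T"
      then have "derives T \<phi>" using that by (intro derives_cases[of a T \<phi>] max)
      then show False using T by contradiction
    qed
  qed
  have disj: "Or a b \<in> T \<longleftrightarrow> a \<in> T \<or> b \<in> T" for a b
  proof
    assume "Or a b \<in> T"
    then have "b \<in> T" if "a \<notin> T" using that neg by (intro fin[of "{Or a b, Neg a}"]) auto
    then show "a \<in> T \<or> b \<in> T" by blast
  next
    assume "a \<in> T \<or> b \<in> T"
    then show "Or a b \<in> T" using fin[of "{a}" "Or a b"] fin[of "{b}" "Or a b"] by auto
  qed
  have eval: "prop_eval (\<lambda>a. a \<in> T) \<psi> \<longleftrightarrow> \<psi> \<in> T" for \<psi>
    by (induction "\<lambda>a. a \<in> T" \<psi> rule: prop_eval.induct) (auto simp: neg disj prop_eval.simps(3,4))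
  have "\<chi> \<in> T" if "Par \<chi>" for \<chi>
    using that by (intro closed) (auto simp: derives_def)
  then have "point (\<lambda>a. a \<in> T)" by (simp add: point_def eval)
  moreover have "\<not> prop_eval (\<lambda>a. a \<in> T) \<phi>"
    using T derives_finite[of "{\<phi>}" T \<phi>] by (auto simp: eval)
  ultimately show ?thesis by blast
qed

lemma Par_iff: "Par \<phi> \<longleftrightarrow> (\<forall>v. point v \<longrightarrow> prop_eval v \<phi>)"
  using separating_point[of \<phi>] by (auto simp: point_def)

section \<open>Reduction axioms as equations at a point\<close>

context
  fixes v :: "('p, 'g) pform \<Rightarrow> bool"
  assumes v: "point v"
begin

lemma eval_Par: "Par \<chi> \<Longrightarrow> prop_eval v \<chi>"
  using v by (simp add: point_def)

lemma eval_Seq: "prop_eval v (Dia (Seq \<gamma> \<delta>) \<phi>) \<longleftrightarrow> prop_eval v (Dia \<gamma> (Dia \<delta> \<phi>))"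
  using eval_Par[OF Par.seq[of \<gamma> \<delta> \<phi>]] by auto

lemma eval_Choice:
  "prop_eval v (Dia (Choice \<gamma> \<delta>) \<phi>) \<longleftrightarrow> prop_eval v (Dia \<gamma> \<phi>) \<or> prop_eval v (Dia \<delta> \<phi>)"
  using eval_Par[OF Par.choice[of \<gamma> \<delta> \<phi>]] by auto

lemma eval_Star:
  "prop_eval v (Dia (Star \<gamma>) \<phi>) \<longleftrightarrow> prop_eval v \<phi> \<or> prop_eval v (Dia \<gamma> (Dia (Star \<gamma>) \<phi>))"
  using eval_Par[OF Par.star[of \<gamma> \<phi>]] by auto

lemma eval_Test: "prop_eval v (Dia (Test \<psi>) \<phi>) \<longleftrightarrow> prop_eval v \<psi> \<and> prop_eval v \<phi>"
  using eval_Par[OF Par.test[of \<psi> \<phi>]] by auto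

lemma eval_Dual: "prop_eval v (Dia (Dual \<gamma>) \<phi>) \<longleftrightarrow> \<not> prop_eval v (Dia \<gamma> (Neg \<phi>))"
  using eval_Par[OF Par.dual[of \<gamma> \<phi>]] by auto

end

text \<open>\<open>eval_Star\<close> is kept out: its right-hand side contains its left-hand side
  inside a modality, and unfolding could go on forever.\<close>

lemmas eval_simps = eval_Seq eval_Choice eval_Test eval_Dual

section \<open>Provable implication and equivalence\<close>

definition fle :: "('p, 'g) pform \<Rightarrow> ('p, 'g) pform \<Rightarrow> bool" where
  "fle a b \<longleftrightarrow> (\<forall>v. point v \<longrightarrow> prop_eval v a \<longrightarrow> prop_eval v b)"

definition gle :: "('p, 'g) pgame \<Rightarrow> ('p, 'g) pgame \<Rightarrow> bool" where
  "gle \<gamma> \<delta> \<longleftrightarrow> (\<forall>\<phi>. fle (Dia \<gamma> \<phi>) (Dia \<delta> \<phi>))"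

definition feq :: "('p, 'g) pform \<Rightarrow> ('p, 'g) pform \<Rightarrow> bool" where
  "feq a b \<longleftrightarrow> fle a b \<and> fle b a"

definition geq :: "('p, 'g) pgame \<Rightarrow> ('p, 'g) pgame \<Rightarrow> bool" where
  "geq \<gamma> \<delta> \<longleftrightarrow> gle \<gamma> \<delta> \<and> gle \<delta> \<gamma>"

lemma fleI: "(\<And>v. point v \<Longrightarrow> prop_eval v a \<Longrightarrow> prop_eval v b) \<Longrightarrow> fle a b"
  and fleD: "fle a b \<Longrightarrow> point v \<Longrightarrow> prop_eval v a \<Longrightarrow> prop_eval v b"
  by (auto simp: fle_def)

text \<open>The bridge to the Hilbert rules: monotonicity and bar induction need a provable
  implication, that is, one true at all points and not just at a given one.\<close>

lemma fle_iff_Par: "fle a b \<longleftrightarrow> Par (Imp a b)"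
  by (auto simp: fle_def Par_iff)

lemma fle_refl: "fle a a" and fle_trans: "fle a b \<Longrightarrow> fle b c \<Longrightarrow> fle a c"
  by (auto simp: fle_def)

lemma gle_refl: "gle \<gamma> \<gamma>" and gle_trans: "gle \<gamma> \<delta> \<Longrightarrow> gle \<delta> \<epsilon> \<Longrightarrow> gle \<gamma> \<epsilon>"
  unfolding gle_def by (blast intro: fle_refl fle_trans)+

lemma feqI: "(\<And>v. point v \<Longrightarrow> prop_eval v a \<longleftrightarrow> prop_eval v b) \<Longrightarrow> feq a b"
  and feqD: "feq a b \<Longrightarrow> point v \<Longrightarrow> prop_eval v a \<longleftrightarrow> prop_eval v b"
  by (auto simp: feq_def fle_def)

lemma geqI: "(\<And>\<phi>. feq (Dia \<gamma> \<phi>) (Dia \<delta> \<phi>)) \<Longrightarrow> geq \<gamma> \<delta>"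
  by (auto simp: geq_def gle_def feq_def)

lemma feq_refl: "feq a a" and feq_sym: "feq a b \<Longrightarrow> feq b a"
  and feq_trans: "feq a b \<Longrightarrow> feq b c \<Longrightarrow> feq a c"
  by (auto simp: feq_def intro: fle_refl fle_trans)

lemma geq_refl: "geq \<gamma> \<gamma>" and geq_sym: "geq \<gamma> \<delta> \<Longrightarrow> geq \<delta> \<gamma>"
  and geq_trans: "geq \<gamma> \<delta> \<Longrightarrow> geq \<delta> \<epsilon> \<Longrightarrow> geq \<gamma> \<epsilon>"
  by (auto simp: geq_def intro: gle_refl gle_trans)

section \<open>Monotonicity, least fixed points and congruence\<close>

lemma Neg_anti: "fle a b \<Longrightarrow> fle (Neg b) (Neg a)"
  by (auto simp: fle_def)

lemma Or_mono: "fle a b \<Longrightarrow> fle c d \<Longrightarrow> fle (Or a c) (Or b d)"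
  by (auto simp: fle_def)

lemma Dia_mono_form: "fle a b \<Longrightarrow> fle (Dia \<gamma> a) (Dia \<gamma> b)"
  by (simp add: fle_iff_Par Par.mon)

lemma Dia_mono: "gle \<gamma> \<delta> \<Longrightarrow> fle a b \<Longrightarrow> fle (Dia \<gamma> a) (Dia \<delta> b)"
  unfolding gle_def by (blast intro: Dia_mono_form fle_trans)

text \<open>Park induction: together with \<open>Star_base\<close> and \<open>Star_step\<close> it
  makes \<open>Dia (Star \<gamma>) a\<close> the least pre-fixed point of the map from
  \<open>X\<close> to \<open>Or a (Dia \<gamma> X)\<close>. Bar induction settles the start
  \<open>b\<close>; monotonicity passes from \<open>a\<close> to \<open>b\<close>.\<close>

lemma Star_least:
  assumes "fle a b" "fle (Dia \<gamma> b) b"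
  shows "fle (Dia (Star \<gamma>) a) b"
proof -
  have "fle (Dia (Star \<gamma>) b) b" using assms(2) by (simp add: fle_iff_Par Par.bar_ind)
  then show ?thesis using Dia_mono_form[OF assms(1)] fle_trans by blast
qed

lemma Star_base: "fle a (Dia (Star \<gamma>) a)"
  by (rule fleI) (subst eval_Star, auto)

lemma Star_step: "fle (Dia \<gamma> (Dia (Star \<gamma>) a)) (Dia (Star \<gamma>) a)"
  by (rule fleI) (subst eval_Star, auto)

lemma Dual_anti:
  assumes "gle \<gamma> \<delta>"
  shows "gle (Dual \<delta>) (Dual \<gamma>)"
  unfolding gle_def
proof (intro allI fleI)
  fix \<phi> v assume "point v" "prop_eval v (Dia (Dual \<delta>) \<phi>)"
  then show "prop_eval v (Dia (Dual \<gamma>) \<phi>)"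
    using fleD[OF Dia_mono[OF assms fle_refl]] by (auto simp: eval_simps)
qed

lemma Seq_mono:
  assumes "gle \<gamma> \<gamma>'" "gle \<delta> \<delta>'"
  shows "gle (Seq \<gamma> \<delta>) (Seq \<gamma>' \<delta>')"
  unfolding gle_def
proof (intro allI fleI)
  fix \<phi> v assume v: "point v" "prop_eval v (Dia (Seq \<gamma> \<delta>) \<phi>)"
  have "fle (Dia \<gamma> (Dia \<delta> \<phi>)) (Dia \<gamma>' (Dia \<delta>' \<phi>))" by (intro Dia_mono assms fle_refl)
  then show "prop_eval v (Dia (Seq \<gamma>' \<delta>') \<phi>)"
    using v by (auto simp: eval_simps dest: fleD)
qed

lemma Choice_mono:
  assumes "gle \<gamma> \<gamma>'" "gle \<delta> \<delta>'"
  shows "gle (Choice \<gamma> \<delta>) (Choice \<gamma>' \<delta>')"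
  using assms by (auto simp: gle_def fle_def eval_simps)

lemma Star_mono:
  assumes "gle \<gamma> \<delta>"
  shows "gle (Star \<gamma>) (Star \<delta>)"
  unfolding gle_def
proof
  fix \<phi>
  \<comment> \<open>By leastness it is enough that the iteration of \<open>\<delta>\<close> is
    closed under \<open>\<gamma>\<close>, which it inherits from closure under the larger
    \<open>\<delta>\<close>.\<close>
  have "fle (Dia \<gamma> (Dia (Star \<delta>) \<phi>)) (Dia (Star \<delta>) \<phi>)"
    using Dia_mono[OF assms fle_refl] Star_step by (rule fle_trans)
  then show "fle (Dia (Star \<gamma>) \<phi>) (Dia (Star \<delta>) \<phi>)"
    by (rule Star_least[OF Star_base])
qed

lemma Test_mono: "fle a b \<Longrightarrow> gle (Test a) (Test b)"
  by (auto simp: gle_def fle_def eval_simps)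

lemma Neg_cong: "feq a b \<Longrightarrow> feq (Neg a) (Neg b)"
  and Or_cong: "feq a b \<Longrightarrow> feq c d \<Longrightarrow> feq (Or a c) (Or b d)"
  and Dia_cong: "geq \<gamma> \<delta> \<Longrightarrow> feq a b \<Longrightarrow> feq (Dia \<gamma> a) (Dia \<delta> b)"
  by (simp_all add: feq_def geq_def Neg_anti Or_mono Dia_mono)

lemma Dual_cong: "geq \<gamma> \<delta> \<Longrightarrow> geq (Dual \<gamma>) (Dual \<delta>)"
  and Seq_cong: "geq \<gamma> \<gamma>' \<Longrightarrow> geq \<delta> \<delta>' \<Longrightarrow> geq (Seq \<gamma> \<delta>) (Seq \<gamma>' \<delta>')"
  and Choice_cong: "geq \<gamma> \<gamma>' \<Longrightarrow> geq \<delta> \<delta>' \<Longrightarrow> geq (Choice \<gamma> \<delta>) (Choice \<gamma>' \<delta>')"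
  and Star_cong: "geq \<gamma> \<delta> \<Longrightarrow> geq (Star \<gamma>) (Star \<delta>)"
  and Test_cong: "feq a b \<Longrightarrow> geq (Test a) (Test b)"
  by (simp_all add: feq_def geq_def Dual_anti Seq_mono Choice_mono Star_mono Test_mono)

lemmas cong_rules = Neg_cong Or_cong Dia_cong Dual_cong Seq_cong Choice_cong Star_cong Test_cong

section \<open>Double negation, duality, translation and complement\<close>

lemma Neg_Neg: "feq (Neg (Neg a)) a"
  by (rule feqI) simp

lemma Neg_Dia:
  fixes \<gamma> :: "('p, 'g) pgame"
  shows "feq (Neg (Dia \<gamma> \<phi>)) (Dia (Dual \<gamma>) (Neg \<phi>))"
proof (rule feqI)
  fix v :: "('p, 'g) pform \<Rightarrow> bool" assume v: "point v"
  show "prop_eval v (Neg (Dia \<gamma> \<phi>)) \<longleftrightarrow> prop_eval v (Dia (Dual \<gamma>) (Neg \<phi>))"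
    \<comment> \<open>The dual axiom leaves a double negation below \<open>\<gamma>\<close>, out of
      reach of propositional evaluation; congruence removes it.\<close>
    using feqD[OF Dia_cong[OF geq_refl Neg_Neg] v] by (simp add: eval_simps[OF v])
qed

lemma Dual_Dual:
  fixes \<gamma> :: "('p, 'g) pgame"
  shows "geq (Dual (Dual \<gamma>)) \<gamma>"
proof (intro geqI feqI)
  fix \<phi> and v :: "('p, 'g) pform \<Rightarrow> bool" assume v: "point v"
  show "prop_eval v (Dia (Dual (Dual \<gamma>)) \<phi>) \<longleftrightarrow> prop_eval v (Dia \<gamma> \<phi>)"
    using feqD[OF Dia_cong[OF geq_refl Neg_Neg] v] by (simp add: eval_simps[OF v])
qed

lemma Dual_Seq:
  fixes \<gamma> :: "('p, 'g) pgame"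
  shows "geq (Dual (Seq \<gamma> \<delta>)) (Seq (Dual \<gamma>) (Dual \<delta>))"
proof (intro geqI feqI)
  fix \<phi> and v :: "('p, 'g) pform \<Rightarrow> bool" assume v: "point v"
  have "feq (Dia \<gamma> (Dia \<delta> (Neg \<phi>))) (Dia \<gamma> (Neg (Dia (Dual \<delta>) \<phi>)))"
    by (intro Dia_cong geq_refl feqI) (simp add: eval_simps)
  from feqD[OF this v]
  show "prop_eval v (Dia (Dual (Seq \<gamma> \<delta>)) \<phi>) \<longleftrightarrow> prop_eval v (Dia (Seq (Dual \<gamma>) (Dual \<delta>)) \<phi>)"
    by (simp add: eval_simps[OF v])
qed

text \<open>The induction follows the recursion of \<open>nf\<close>, which pushes negation and dual
  inward. Translating back then yields doubled negations or duals, cancelled by congruence; negated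
  modalities and dual compositions use \<open>Neg_Dia\<close> and \<open>Dual_Seq\<close>.\<close>

lemma par_nf:
  fixes \<phi> :: "('p, 'g) pform" and \<gamma> :: "('p, 'g) pgame"
  shows "feq (par (nf \<phi>)) \<phi>" and "geq (par_game (nf_game \<gamma>)) \<gamma>"
proof (induction \<phi> and \<gamma> rule: nf_nf_game.induct)
  case (3 \<phi>)
  then show ?case using feq_trans[OF _ feq_sym[OF Neg_Neg]] by simp
next
  case (5 \<phi> \<psi>)
  have "feq (par (nf (Neg (Or \<phi> \<psi>)))) (Neg (Or (Neg (Neg \<phi>)) (Neg (Neg \<psi>))))"
    using 5 by (simp add: cong_rules)
  then show ?case by (rule feq_trans) (intro cong_rules Neg_Neg)
next
  case (7 \<gamma> \<phi>)
  then have "feq (par (nf (Neg (Dia \<gamma> \<phi>)))) (Dia (Dual \<gamma>) (Neg \<phi>))"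
    by (simp add: cong_rules)
  then show ?case by (rule feq_trans[OF _ feq_sym[OF Neg_Dia]])
next
  case (14 \<gamma>)
  then show ?case using geq_trans[OF _ geq_sym[OF Dual_Dual]] by simp
next
  case (15 \<gamma> \<delta>)
  then have "geq (par_game (nf_game (Dual (Choice \<gamma> \<delta>))))
      (Dual (Choice (Dual (Dual \<gamma>)) (Dual (Dual \<delta>))))"
    by (simp add: cong_rules)
  then show ?case by (rule geq_trans) (intro cong_rules Dual_Dual)
next
  case (16 \<gamma> \<delta>)
  then have "geq (par_game (nf_game (Dual (Seq \<gamma> \<delta>)))) (Seq (Dual \<gamma>) (Dual \<delta>))"
    by (simp add: cong_rules)
  then show ?case by (rule geq_trans[OF _ geq_sym[OF Dual_Seq]])
next
  case (17 \<gamma>)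
  then have "geq (par_game (nf_game (Dual (Star \<gamma>)))) (Dual (Star (Dual (Dual \<gamma>))))"
    by (simp add: cong_rules)
  then show ?case by (rule geq_trans) (intro cong_rules Dual_Dual)
next
  case (18 \<phi>)
  then have "geq (par_game (nf_game (Dual (Test \<phi>)))) (Dual (Test (Neg (Neg \<phi>))))"
    by (simp add: cong_rules)
  then show ?case by (rule geq_trans) (intro cong_rules Neg_Neg)
qed (simp_all add: cong_rules feq_refl geq_refl)

text \<open>Modalities and tests mix the two sorts, which forces a simultaneous induction. The
  formula part gives the conjunctions of complements in the axiom and in strengthened iteration
  their meaning as negated sequents.\<close>

lemma par_compl:
  fixes \<phi> :: "('p, 'g) nform" and \<gamma> :: "('p, 'g) ngame"
  shows "feq (par (compl \<phi>)) (Neg (par \<phi>))"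
    and "geq (par_game (compl_game \<gamma>)) (Dual (par_game \<gamma>))"
proof (induction \<phi> and \<gamma> rule: nform.induct ngame.induct)
  case (NAtom p)
  then show ?case by (simp add: feq_refl)
next
  case (NNegAtom p)
  then show ?case by (simp add: feq_sym[OF Neg_Neg])
next
  case (NOr a b)
  then have "feq (par (compl (NOr a b))) (Neg (Or (Neg (Neg (par a))) (Neg (Neg (par b)))))"
    by (simp add: cong_rules)
  also have "feq \<dots> (Neg (par (NOr a b)))" by (simp add: cong_rules Neg_Neg)
  finally (feq_trans) show ?case .
next
  case (NAnd a b)
  then have "feq (par (compl (NAnd a b))) (Or (Neg (par a)) (Neg (par b)))"
    by (simp add: cong_rules)
  also have "feq \<dots> (Neg (par (NAnd a b)))" by (simp add: feq_sym[OF Neg_Neg])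
  finally (feq_trans) show ?case .
next
  case (NDia \<gamma> a)
  then have "feq (par (compl (NDia \<gamma> a))) (Dia (Dual (par_game \<gamma>)) (Neg (par a)))"
    by (simp add: cong_rules)
  also have "feq \<dots> (Neg (par (NDia \<gamma> a)))" by (simp add: feq_sym[OF Neg_Dia])
  finally (feq_trans) show ?case .
next
  case (NGame g)
  then show ?case by (simp add: geq_refl)
next
  case (NDualGame g)
  then show ?case by (simp add: geq_sym[OF Dual_Dual])
next
  case (NSeq \<gamma> \<delta>)
  then have "geq (par_game (compl_game (NSeq \<gamma> \<delta>))) (Seq (Dual (par_game \<gamma>)) (Dual (par_game \<delta>)))"
    by (simp add: cong_rules)
  also have "geq \<dots> (Dual (par_game (NSeq \<gamma> \<delta>)))" by (simp add: geq_sym[OF Dual_Seq])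
  finally (geq_trans) show ?case .
next
  case (NChoice \<gamma> \<delta>)
  then have "geq (par_game (compl_game (NChoice \<gamma> \<delta>)))
      (Dual (Choice (Dual (Dual (par_game \<gamma>))) (Dual (Dual (par_game \<delta>)))))"
    by (simp add: cong_rules)
  also have "geq \<dots> (Dual (par_game (NChoice \<gamma> \<delta>)))" by (simp add: cong_rules Dual_Dual)
  finally (geq_trans) show ?case .
next
  case (NDChoice \<gamma> \<delta>)
  then have "geq (par_game (compl_game (NDChoice \<gamma> \<delta>)))
      (Choice (Dual (par_game \<gamma>)) (Dual (par_game \<delta>)))"
    by (simp add: cong_rules)
  also have "geq \<dots> (Dual (par_game (NDChoice \<gamma> \<delta>)))" by (simp add: geq_sym[OF Dual_Dual])
  finally (geq_trans) show ?case .
next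
  case (NStar \<gamma>)
  then have "geq (par_game (compl_game (NStar \<gamma>))) (Dual (Star (Dual (Dual (par_game \<gamma>)))))"
    by (simp add: cong_rules)
  also have "geq \<dots> (Dual (par_game (NStar \<gamma>)))" by (simp add: cong_rules Dual_Dual)
  finally (geq_trans) show ?case .
next
  case (NCross \<gamma>)
  then have "geq (par_game (compl_game (NCross \<gamma>))) (Star (Dual (par_game \<gamma>)))"
    by (simp add: cong_rules)
  also have "geq \<dots> (Dual (par_game (NCross \<gamma>)))" by (simp add: geq_sym[OF Dual_Dual])
  finally (geq_trans) show ?case .
next
  case (NTest a)
  then have "geq (par_game (compl_game (NTest a))) (Dual (Test (Neg (Neg (par a)))))"
    by (simp add: cong_rules)
  also have "geq \<dots> (Dual (par_game (NTest a)))" by (simp add: cong_rules Neg_Neg)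
  finally (geq_trans) show ?case .
next
  case (NDTest a)
  then have "geq (par_game (compl_game (NDTest a))) (Test (Neg (par a)))"
    by (simp add: cong_rules)
  also have "geq \<dots> (Dual (par_game (NDTest a)))" by (simp add: geq_sym[OF Dual_Dual])
  finally (geq_trans) show ?case .
qed

section \<open>Soundness of the sequent rules\<close>

lemmas mono_rules = Neg_anti Or_mono Dia_mono Dual_anti Seq_mono Choice_mono Star_mono Test_mono
  fle_refl gle_refl

text \<open>Normal-form contexts are positive: translated conjunctions and demonic constructors put
  the hole below an even number of negations and duals, so the antitone rules cancel in
  pairs.\<close>

lemma ffill_mono:
  assumes "fle (par a) (par b)"
  shows "fle (par (ffill C a)) (par (ffill C b))"
    and "gle (par_game (fgfill D a)) (par_game (fgfill D b))"
  by (induction C and D rule: fctx.induct fgctx.induct) (simp_all add: assms mono_rules)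

lemma gfill_mono:
  assumes "gle (par_game \<gamma>) (par_game \<delta>)"
  shows "fle (par (gfill C \<gamma>)) (par (gfill C \<delta>))"
    and "gle (par_game (ggfill D \<gamma>)) (par_game (ggfill D \<delta>))"
  by (induction C and D rule: gctx.induct ggctx.induct) (simp_all add: assms mono_rules)

section \<open>Demonic constructors and greatest fixed points\<close>

context
  fixes v :: "('p, 'g) pform \<Rightarrow> bool"
  assumes v: "point v"
begin

lemma eval_DTest:
  "prop_eval v (Dia (Dual (Test (Neg \<psi>))) \<phi>) \<longleftrightarrow> prop_eval v \<psi> \<or> prop_eval v \<phi>"
  using v by (auto simp: eval_simps)

lemma eval_DChoice:
  "prop_eval v (Dia (Dual (Choice (Dual \<gamma>) (Dual \<delta>))) \<phi>) \<longleftrightarrow>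
     prop_eval v (Dia \<gamma> \<phi>) \<and> prop_eval v (Dia \<delta> \<phi>)"
  using feqD[OF Dia_cong[OF geq_refl Neg_Neg] v] by (simp add: eval_simps[OF v])

lemma eval_Cross:
  "prop_eval v (Dia (Dual (Star (Dual \<gamma>))) \<phi>) \<longleftrightarrow>
     prop_eval v \<phi> \<and> prop_eval v (Dia \<gamma> (Dia (Dual (Star (Dual \<gamma>))) \<phi>))"
proof -
  \<comment> \<open>Unfolding the star of \<open>Dual \<gamma>\<close> leaves a negated star below
    \<open>\<gamma>\<close>; congruence refolds it there into the demonic iteration.\<close>
  have "feq (Dia \<gamma> (Neg (Dia (Star (Dual \<gamma>)) (Neg \<phi>)))) (Dia \<gamma> (Dia (Dual (Star (Dual \<gamma>))) \<phi>))"
    by (intro Dia_cong geq_refl feqI) (simp add: eval_simps)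
  from feqD[OF this v] eval_Star[OF v, of "Dual \<gamma>" "Neg \<phi>"]
  show ?thesis by (simp add: eval_Dual[OF v])
qed

end

text \<open>Coinduction by contraposing \<open>Star_least\<close>: if \<open>b\<close> is a
  post-fixed point for \<open>\<gamma>\<close>, then \<open>Neg b\<close> is a pre-fixed point for
  the dual game.\<close>

lemma Cross_greatest:
  assumes "fle b a" "fle b (Dia \<gamma> b)"
  shows "fle b (Dia (Dual (Star (Dual \<gamma>))) a)"
proof -
  have "fle (Dia (Dual \<gamma>) (Neg b)) (Neg b)"
    using Neg_anti[OF assms(2)] feqD[OF Neg_Dia] by (auto simp: fle_def)
  from Star_least[OF Neg_anti[OF assms(1)] this]
  show ?thesis by (auto simp: fle_def eval_Dual)
qed

lemma eval_compl_conj: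
  assumes "compl_conj \<Phi> \<chi>" "point v"
  shows "prop_eval v (par \<chi>) \<longleftrightarrow> (\<forall>\<phi>. \<phi> |\<in>| \<Phi> \<longrightarrow> \<not> prop_eval v (par \<phi>))"
  using assms by (induction rule: compl_conj.induct) (auto simp: feqD[OF par_compl(1)])

lemma strong_cross_invariant:
  fixes \<gamma> :: "('p, 'g) pgame"
  defines "J \<equiv> \<lambda>\<chi> \<phi>. Dia (Dual (Star (Dual (Seq (Dual (Test (Neg \<chi>))) \<gamma>))))
                 (Dia (Dual (Test (Neg \<chi>))) \<phi>)"
  assumes "fle \<chi> \<phi>" "fle \<chi> (Dia \<gamma> (J \<chi> \<phi>))"
  shows "fle \<chi> (Dia (Dual (Star (Dual \<gamma>))) \<phi>)"
proof -
  \<comment> \<open>The test before \<open>\<phi>\<close> contributes the first conjunct, the test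
    opening the loop body the second.\<close>
  have unfold: "prop_eval v (J \<chi> \<phi>) \<longleftrightarrow> (prop_eval v \<chi> \<or> prop_eval v \<phi>) \<and>
      (prop_eval v \<chi> \<or> prop_eval v (Dia \<gamma> (J \<chi> \<phi>)))" if "point v" for v
    unfolding J_def by (subst eval_Cross[OF that]) (simp add: eval_DTest[OF that] eval_Seq[OF that])
  \<comment> \<open>Where \<open>\<chi>\<close> fails, the unfolding gives both conclusions; where
    it holds, the assumptions on \<open>\<chi>\<close> do.\<close>
  have "fle (J \<chi> \<phi>) \<phi>" "fle (J \<chi> \<phi>) (Dia \<gamma> (J \<chi> \<phi>))"
    using assms(2,3) by (auto simp: fle_def unfold)
  then have "fle (J \<chi> \<phi>) (Dia (Dual (Star (Dual \<gamma>))) \<phi>)" by (rule Cross_greatest)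
  moreover have "fle \<chi> (J \<chi> \<phi>)" using unfold by (auto simp: fle_def)
  ultimately show ?thesis by (blast intro: fle_trans)
qed

section \<open>Validity of sequents and its preservation\<close>

text \<open>Truth of some member at each point replaces a disjunction formula, for which a finite
  set fixes no order.\<close>

definition valid_seq :: "('p, 'g) nform fset \<Rightarrow> bool" where
  "valid_seq \<Phi> \<longleftrightarrow> (\<forall>v. point v \<longrightarrow> (\<exists>\<phi>. \<phi> |\<in>| \<Phi> \<and> prop_eval v (par \<phi>)))"

lemma valid_seq_finsert:
  "valid_seq (finsert \<phi> \<Phi>) \<longleftrightarrow>
     (\<forall>v. point v \<longrightarrow> (\<forall>\<psi>. \<psi> |\<in>| \<Phi> \<longrightarrow> \<not> prop_eval v (par \<psi>)) \<longrightarrow> prop_eval v (par \<phi>))"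
  by (auto simp: valid_seq_def)

text \<open>Serves the rules that rewrite a single formula: the side formulas pass through
  unchanged.\<close>

lemma valid_seq_mono: "valid_seq (finsert \<phi> \<Phi>) \<Longrightarrow> fle (par \<phi>) (par \<psi>) \<Longrightarrow> valid_seq (finsert \<psi> \<Phi>)"
  by (auto simp: valid_seq_finsert dest: fleD)

lemma G_seq_sound: "G_seq \<Phi> \<Longrightarrow> valid_seq \<Phi>"
proof (induction rule: G_seq.induct)
  case (ax \<Phi> \<chi>)
  then show ?case by (simp add: valid_seq_finsert eval_compl_conj)
next
  case (weak \<Phi> \<phi>)
  then show ?case by (auto simp: valid_seq_def)
next
  case (modal \<phi> \<psi> g)
  \<comment> \<open>Without side formulas the premise is an implication true at all points, as the
    monotonicity rule demands.\<close>
  then have "fle (Neg (par \<psi>)) (par \<phi>)" by (auto simp: valid_seq_def fle_def)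
  then have "fle (Dia (Game g) (Neg (par \<psi>))) (Dia (Game g) (par \<phi>))" by (rule Dia_mono_form)
  then show ?case by (auto simp: valid_seq_finsert eval_Dual dest: fleD)
next
  case (disj \<phi> \<psi> \<Phi>)
  then show ?case by (auto simp: valid_seq_finsert)
next
  case (conj \<phi> \<Phi> \<psi>)
  then show ?case by (auto simp: valid_seq_finsert)
next
  case (star \<phi> \<gamma> \<Phi>)
  \<comment> \<open>The unfolding equation is used right to left, to fold the premise into the
    conclusion.\<close>
  show ?case by (rule valid_seq_mono[OF star.IH], rule fleI) (simp add: eval_Star[symmetric])
next
  case (cross \<phi> \<gamma> \<Phi>)
  show ?case by (rule valid_seq_mono[OF cross.IH], rule fleI) (simp add: eval_Cross[symmetric])
next
  case (choice \<gamma> \<phi> \<delta> \<Phi>)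
  show ?case by (rule valid_seq_mono[OF choice.IH], rule fleI) (simp add: eval_Choice)
next
  case (dchoice \<gamma> \<phi> \<delta> \<Phi>)
  show ?case by (rule valid_seq_mono[OF dchoice.IH], rule fleI) (simp add: eval_DChoice)
next
  case (test \<psi> \<phi> \<Phi>)
  show ?case by (rule valid_seq_mono[OF test.IH], rule fleI) (simp add: eval_Test)
next
  case (dtest \<psi> \<phi> \<Phi>)
  show ?case by (rule valid_seq_mono[OF dtest.IH], rule fleI) (simp add: eval_DTest)
next
  case (deep_dtest_game C \<gamma> \<Phi> \<chi>)
  \<comment> \<open>A demonic test only adds the disjunct \<open>\<chi>\<close>, so prefixing it
    enlarges the game, and the context preserves this.\<close>
  have "gle (par_game \<gamma>) (par_game (NSeq (NDTest \<chi>) \<gamma>))"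
    by (auto simp: gle_def intro!: fleI simp: eval_Seq eval_DTest)
  then show ?case by (rule valid_seq_mono[OF deep_dtest_game.IH gfill_mono(1)])
next
  case (deep_dtest_form D \<phi> \<Phi> \<chi>)
  have "fle (par \<phi>) (par (NDia (NDTest \<chi>) \<phi>))"
    by (auto intro!: fleI simp: eval_DTest)
  then show ?case by (rule valid_seq_mono[OF deep_dtest_form.IH ffill_mono(1)])
next
  case (deep_seq D \<gamma> \<delta> \<phi> \<Phi>)
  have "fle (par (NDia \<gamma> (NDia \<delta> \<phi>))) (par (NDia (NSeq \<gamma> \<delta>) \<phi>))"
    by (auto intro!: fleI simp: eval_Seq)
  then show ?case by (rule valid_seq_mono[OF deep_seq.IH ffill_mono(1)])
next
  case (cross_strong \<Phi> \<chi> \<phi> \<gamma>)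
  \<comment> \<open>All side formulas fail exactly where \<open>\<chi>\<close> holds, so premise and
    conclusion both become implications from \<open>\<chi>\<close>.\<close>
  have rewrite: "valid_seq (finsert \<xi> \<Phi>) \<longleftrightarrow> fle (par \<chi>) (par \<xi>)" for \<xi>
    using eval_compl_conj[OF cross_strong.hyps(1)] by (auto simp: valid_seq_finsert fle_def)
  show ?case
    using cross_strong.IH strong_cross_invariant[of "par \<chi>" "par \<phi>" "par_game \<gamma>"]
    unfolding rewrite by (auto simp: fle_def)
qed

theorem theorem3:
  shows "(\<forall>\<phi> :: ('p::countable, 'g::countable) pform. G (nf \<phi>) \<longrightarrow> Par \<phi>) \<and>
    (\<forall>\<xi> :: ('p, 'g) nform. G \<xi> \<longrightarrow> Par (par \<xi>))"
proof -
  \<comment> \<open>For a one-element sequent, validity is truth of \<open>par \<xi>\<close> at all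
    points, hence provability.\<close>
  have par: "Par (par \<xi>)" if "G \<xi>" for \<xi> :: "('p, 'g) nform"
    using G_seq_sound[OF that[unfolded G_def]] by (auto simp: valid_seq_def Par_iff)
  moreover have "Par \<phi>" if "G (nf \<phi>)" for \<phi> :: "('p, 'g) pform"
    using par[OF that] feqD[OF par_nf(1), of _ \<phi>] by (auto simp: Par_iff)
  ultimately show ?thesis by blast
qed

end
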